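(* Let $I$, $J$, $K\subseteq\mathbb{R}$ be open intervals, and let $E$, $F$, $G$ be normalizable semideviations on $I$, $J$, $K$, respectively, with normalizations $E^*,F^*,G^*$. Let $f\colon J\times K\to I$ be a differentiable function. Then the following three assertions are equivalent: (i) for all means $M\in\{\underline{\underline{\mathcal{D}}}_F,\underline{\mathcal{D}}_F,\overline{\mathcal{D}}_F,\overline{\overline{\mathcal{D}}}_F\}$ and $N\in\{\underline{\underline{\mathcal{D}}}_G,\underline{\mathcal{D}}_G,\overline{\mathcal{D}}_G,\overline{\overline{\mathcal{D}}}_G\}$, for all $n\in\mathbb{N}$, $x\in J^n$, $y\in K^n$ and $\lambda\in W_n(\mathbb{R})$, $$\underline{\underline{\mathcal{D}}}_E\big(f(x,y),\lambda\big)\le f\big(M(x,\lambda),N(y,\lambda)\big);$$ (ii) there exist means $M\in\{\underline{\underline{\mathcal{D}}}_F,\underline{\mathcal{D}}_F,\overline{\mathcal{D}}_F,\overline{\overline{\mathcal{D}}}_F\}$ and $N\in\{\underline{\underline{\mathcal{D}}}_G,\underline{\mathcal{D}}_G,\overline{\mathcal{D}}_G,\overline{\overline{\mathcal{D}}}_G\}$ such that, for all $n\in\mathbb{N}$, $x\in J^n$, $y\in K^n$ and $\lambda\in W_n(\mathbb{R})$, the inequality $\underline{\underline{\mathcal{D}}}_E(f(x,y),\lambda)\le f(M(x,\lambda),N(y,\lambda))$ holds; (iii) for all $p,u\in J$ and $q,v\in K$, $$E^*\big(f(p,q),f(u,v)\big)\le\partial_1f(u,v)\,F^*(p,u)+\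partial_2f(u,v)\,G^*(q,v).$$
   Context: For $x=(x_1,\dots,x_n)\in J^n$ and $y=(y_1,\dots,y_n)\in K^n$, $f(x,y):=(f(x_1,y_1),\dots,f(x_n,y_n))\in I^n$. For $n\in\mathbb{N}$, $W_n(\mathbb{R})=\{(\lambda_1,\dots,\lambda_n)\in\mathbb{R}^n\mid\lambda_i\ge0\ \forall i,\ \lambda_1+\dots+\lambda_n>0\}$. For an interval $I$, a function $E\colon I\times I\to\mathbb{R}$ is a semideviation on $I$ if for all distinct $x,y\in I$ the sign of $E(x,y)$ equals the sign of $x-y$. For $(x,\lambda)\in I^n\times W_n(\mathbb{R})$ let $e(y)=\lambda_1E(x_1,y)+\cdots+\lambda_nE(x_n,y)$, $y\in I$, and define $\underline{\underline{\mathcal{D}}}_E(x,\lambda)=\inf\{y\in I\mid e(y)\le0\}$, $\ \overline{\overline{\mathcal{D}}}_E(x,\lambda)=\sup\{y\in I\mid e(y)\ge0\}$, $\underline{\mathcal{D}}_E(x,\lambda)=\inf\{y\in I\mid e(y)<0\}$, $\ \overline{\mathcal{D}}_E(x,\lambda)=\sup\{y\in I\mid e(y)>0\}$. A semideviation $E\colon I\times I\to\mathbb{R}$ is normalizable if (a) for all $x\in I$ the function $y\mapsto E(x,y)$ is continuous on $I$; (b) for all $x\in I$ the function $y\mapsto E(x,y)$ is differentiable at $y=x$ (with derivative $\partial_2E(x,x)$); (c) $x\mapsto\partial_2E(x,x)$ is strictly negative and continuous on $I$. Its normalization is $E^*(x,y)=\dfrac{E(x,y)}{-\partial_2E(y,y)}$.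 ($\partial_i$ denotes partial derivative with respect to the $i$-th variable.) *)

theory Defs
  imports "HOL-Analysis.Analysis"
begin

text \<open>An \<open>n\<close>-tuple is a function \<open>nat \<Rightarrow> real\<close> of which only the values on \<open>{1..n}\<close> are used;
  \<open>x \<in> {1..n} \<rightarrow> J\<close> renders \<open>x \<in> J\<^sup>n\<close>. A function on \<open>I \<times> I\<close> is a curried total function of which
  only the values on \<open>I\<close> are used.\<close>

definition weights :: "nat \<Rightarrow> (nat \<Rightarrow> real) set" where
  "weights n = {w. (\<forall>i\<in>{1..n}. 0 \<le> w i) \<and> 0 < (\<Sum>i=1..n. w i)}"

definition semideviation :: "real set \<Rightarrow> (real \<Rightarrow> real \<Rightarrow> real) \<Rightarrow> bool" where
  "semideviation I E \<longleftrightarrow> (\<forall>x\<in>I. \<forall>y\<in>I. x \<noteq> y \<longrightarrow> sgn (E x y) = sgn (x - y))"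

definition dev_sum ::
  "(real \<Rightarrow> real \<Rightarrow> real) \<Rightarrow> nat \<Rightarrow> (nat \<Rightarrow> real) \<Rightarrow> (nat \<Rightarrow> real) \<Rightarrow> real \<Rightarrow> real" where
  "dev_sum E n x w y = (\<Sum>i=1..n. w i * E (x i) y)"

text \<open>The four means, in the order \<open>D\<close> with two lower bars, one lower bar, one upper bar, two upper
  bars. For a semideviation on an open interval \<open>I\<close>, \<open>x \<in> I\<^sup>n\<close> and \<open>w \<in> weights n\<close>, the sets below
  are nonempty and bounded on the relevant side, so that \<open>Inf\<close> and \<open>Sup\<close> are genuine.\<close>

definition D_lower2 ::
  "real set \<Rightarrow> (real \<Rightarrow> real \<Rightarrow> real) \<Rightarrow> nat \<Rightarrow> (nat \<Rightarrow> real) \<Rightarrow> (nat \<Rightarrow> real) \<Rightarrow> real" where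
  "D_lower2 I E n x w = Inf {y \<in> I. dev_sum E n x w y \<le> 0}"

definition D_lower ::
  "real set \<Rightarrow> (real \<Rightarrow> real \<Rightarrow> real) \<Rightarrow> nat \<Rightarrow> (nat \<Rightarrow> real) \<Rightarrow> (nat \<Rightarrow> real) \<Rightarrow> real" where
  "D_lower I E n x w = Inf {y \<in> I. dev_sum E n x w y < 0}"

definition D_upper ::
  "real set \<Rightarrow> (real \<Rightarrow> real \<Rightarrow> real) \<Rightarrow> nat \<Rightarrow> (nat \<Rightarrow> real) \<Rightarrow> (nat \<Rightarrow> real) \<Rightarrow> real" where
  "D_upper I E n x w = Sup {y \<in> I. dev_sum E n x w y > 0}"

definition D_upper2 ::
  "real set \<Rightarrow> (real \<Rightarrow> real \<Rightarrow> real) \<Rightarrow> nat \<Rightarrow> (nat \<Rightarrow> real) \<Rightarrow> (nat \<Rightarrow> real) \<Rightarrow> real" where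
  "D_upper2 I E n x w = Sup {y \<in> I. dev_sum E n x w y \<ge> 0}"

definition dev_means ::
  "real set \<Rightarrow> (real \<Rightarrow> real \<Rightarrow> real) \<Rightarrow> (nat \<Rightarrow> (nat \<Rightarrow> real) \<Rightarrow> (nat \<Rightarrow> real) \<Rightarrow> real) set" where
  "dev_means I E = {D_lower2 I E, D_lower I E, D_upper I E, D_upper2 I E}"

definition normalizable :: "real set \<Rightarrow> (real \<Rightarrow> real \<Rightarrow> real) \<Rightarrow> bool" where
  "normalizable I E \<longleftrightarrow>
     semideviation I E \<and>
     (\<forall>x\<in>I. continuous_on I (E x)) \<and>
     (\<forall>x\<in>I. (E x) differentiable (at x within I)) \<and>
     (\<forall>x\<in>I. deriv (E x) x < 0) \<and>
     continuous_on I (\<lambda>x. deriv (E x) x)"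

text \<open>\<^term>\<open>deriv (E x) x\<close> is the two-sided derivative of \<open>E x\<close> at \<open>x\<close>; for open \<open>I\<close> it depends only
  on the values of \<open>E\<close> on \<open>I \<times> I\<close> and coincides with the derivative within \<open>I\<close>.\<close>

definition normalization :: "(real \<Rightarrow> real \<Rightarrow> real) \<Rightarrow> real \<Rightarrow> real \<Rightarrow> real" where
  "normalization E x y = E x y / (- deriv (E y) y)"

end

theory Submission
  imports Defs
begin

text \<open>By continuity, each of the four means of a normalizable semideviation is a zero of the deviation
  sum. Hence (iii), summed with weights at \<open>u = M(x, w)\<close> and \<open>v = N(y, w)\<close>, has right-hand side zero,
  which gives (i). Conversely, the mean of the points \<open>p, u\<close> with weights \<open>\<epsilon>, 1\<close> is
  \<open>u + \<epsilon> F\<^sup>*(p, u) + o(\<epsilon>)\<close>; applying (ii) to \<open>(p, q)\<close> and \<open>(u, v)\<close> with weights \<open>\<epsilon>, 1\<close> and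
  differentiating at \<open>\<epsilon> = 0\<close> gives (iii).\<close>

section \<open>Infima and suprema at a change of sign\<close>

text \<open>Admitting every \<open>S\<close> between the strict and the weak sublevel set treats
  both lower means at once. If \<open>g\<close> were positive at \<open>Inf S\<close>, it would be
  so on a neighbourhood, and \<open>S\<close> would have no points near its infimum; if
  \<open>g\<close> were negative there, points to the left of the infimum would lie in
  \<open>S\<close>.\<close>

lemma Inf_sign_change:
  fixes g :: "real \<Rightarrow> real"
  assumes "open I" "is_interval I" "continuous_on I g" "a \<in> I" "b \<in> I" "a \<le> b"
    and pos: "\<And>y. y \<in> I \<Longrightarrow> y < a \<Longrightarrow> 0 < g y"
    and neg: "\<And>y. y \<in> I \<Longrightarrow> b < y \<Longrightarrow> g y < 0"
    and lo: "{y \<in> I. g y < 0} \<subseteq> S" and hi: "S \<subseteq> {y \<in> I. g y \<le> 0}"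
  shows "Inf S \<in> {a..b}" and "g (Inf S) = 0"
proof -
  define z where "z = Inf S"
  have aS: "a \<le> s" if "s \<in> S" for s
    using pos[of s] that hi by force
  then have bdd: "bdd_below S" by (auto simp: bdd_below_def)
  \<comment> \<open>Openness supplies points of \<open>I\<close> just beyond \<open>b\<close>; they
    lie in \<open>S\<close>, which makes \<open>S\<close> nonempty and gives
    \<open>z \<le> b\<close>.\<close>
  obtain d where d: "d > 0" "\<And>y. \<bar>y - b\<bar> < d \<Longrightarrow> y \<in> I"
    using \<open>open I\<close> \<open>b \<in> I\<close> by (auto simp: open_dist dist_real_def)
  have rS: "y \<in> S" if "b < y" "y < b + d" for y
    using d(2)[of y] neg[of y] that lo by auto
  have "S \<noteq> {}" using rS[of "b + d / 2"] d(1) by auto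
  have "a \<le> z" unfolding z_def using \<open>S \<noteq> {}\<close> aS by (rule cInf_greatest)
  moreover have "z \<le> b"
  proof (rule dense_ge_bounded)
    show "b < b + d" using d by simp
    show "z \<le> y" if "b < y" "y < b + d" for y
      unfolding z_def using rS[OF that] bdd by (rule cInf_lower)
  qed
  ultimately have z: "z \<in> {a..b}" by auto
  then have "z \<in> I"
    using mem_is_interval_1_I[OF assms(2,4,5)] by auto
  have "\<not> 0 < g z"
  proof
    assume "0 < g z"
    moreover have "open (I \<inter> g -` {0<..})"
      using assms(1,3) by (intro continuous_open_preimage) auto
    ultimately obtain r where "r > 0" and ball: "ball z r \<subseteq> I \<inter> g -` {0<..}"
      using \<open>z \<in> I\<close> by (metis IntI vimageI openE greaterThan_iff)
    then have r: "r > 0" "\<And>y. \<bar>y - z\<bar> < r \<Longrightarrow> 0 < g y"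
      by (auto simp: subset_iff dist_real_def abs_minus_commute)
    obtain s where s: "s \<in> S" "s < z + r"
      using cInf_lessD[OF \<open>S \<noteq> {}\<close>, of "z + r"] r by (auto simp: z_def)
    then have "z \<le> s" unfolding z_def using bdd by (simp add: cInf_lower)
    then show False using r(2)[of s] s hi by force
  qed
  moreover have "\<not> g z < 0"
  proof
    assume "g z < 0"
    moreover have "open (I \<inter> g -` {..<0})"
      using assms(1,3) by (intro continuous_open_preimage) auto
    ultimately obtain r where "r > 0" and ball: "ball z r \<subseteq> I \<inter> g -` {..<0}"
      using \<open>z \<in> I\<close> by (metis IntI vimageI openE lessThan_iff)
    then have r: "r > 0" "\<And>y. \<bar>y - z\<bar> < r \<Longrightarrow> y \<in> I \<and> g y < 0"
      by (auto simp: subset_iff dist_real_def abs_minus_commute)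
    then have "z - r / 2 \<in> S" using r(2)[of "z - r / 2"] lo by auto
    then have "z \<le> z - r / 2" unfolding z_def using bdd by (simp add: cInf_lower)
    then show False using r by simp
  qed
  ultimately show "Inf S \<in> {a..b}" "g (Inf S) = 0" using z by (auto simp: z_def)
qed

text \<open>Reduces to the infimum by reflection: \<open>\<lambda>y. - g (- y)\<close> again passes
  from positive to negative, now between \<open>- b\<close> and \<open>- a\<close>.\<close>

lemma Sup_sign_change:
  fixes g :: "real \<Rightarrow> real"
  assumes "open I" "is_interval I" "continuous_on I g" "a \<in> I" "b \<in> I" "a \<le> b"
    and pos: "\<And>y. y \<in> I \<Longrightarrow> y < a \<Longrightarrow> 0 < g y"
    and neg: "\<And>y. y \<in> I \<Longrightarrow> b < y \<Longrightarrow> g y < 0"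
    and lo: "{y \<in> I. 0 < g y} \<subseteq> S" and hi: "S \<subseteq> {y \<in> I. 0 \<le> g y}"
  shows "Sup S \<in> {a..b}" and "g (Sup S) = 0"
proof -
  have cont: "continuous_on (uminus ` I) (\<lambda>y. - g (- y))"
    by (intro continuous_intros continuous_on_compose2[OF assms(3)]) auto
  have int: "is_interval (uminus ` I)"
    using assms(2) by simp
  have eq: "Sup S = - Inf (uminus ` S)"
    by (simp add: Inf_real_def image_image)
  have 1: "Inf (uminus ` S) \<in> {-b..-a}" and 2: "- g (- Inf (uminus ` S)) = 0"
    using open_negations[OF assms(1)] int cont assms(4-6) pos neg lo hi
    by (intro Inf_sign_change[of "uminus ` I" "\<lambda>y. - g (- y)" "- b" "- a" "uminus ` S"]; force)+
  show "Sup S \<in> {a..b}" "g (Sup S) = 0"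
    using 1 2 by (auto simp: eq)
qed

section \<open>Signs of semideviations and of deviation sums\<close>

lemma semideviation_pos: "semideviation I E \<Longrightarrow> x \<in> I \<Longrightarrow> y \<in> I \<Longrightarrow> y < x \<Longrightarrow> 0 < E x y"
  unfolding semideviation_def by (metis diff_gt_0_iff_gt less_irrefl sgn_greater)

lemma semideviation_neg: "semideviation I E \<Longrightarrow> x \<in> I \<Longrightarrow> y \<in> I \<Longrightarrow> x < y \<Longrightarrow> E x y < 0"
  unfolding semideviation_def by (metis diff_less_0_iff_less less_irrefl sgn_less)

lemma weights_pos_index:
  assumes "w \<in> weights n"
  obtains i where "i \<in> {1..n}" "0 < w i"
proof -
  have "\<not> (\<forall>i\<in>{1..n}. w i \<le> 0)"
    using assms sum_nonpos[of "{1..n}" w] by (force simp: weights_def)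
  then show ?thesis using that by force
qed

lemma dev_sum_pos:
  assumes "semideviation I E" "x \<in> {1..n} \<rightarrow> I" "w \<in> weights n" "y \<in> I"
    and "\<And>i. i \<in> {1..n} \<Longrightarrow> y < x i"
  shows "0 < dev_sum E n x w y"
proof -
  obtain j where j: "j \<in> {1..n}" "0 < w j" using weights_pos_index[OF assms(3)] .
  have E: "0 < E (x i) y" if "i \<in> {1..n}" for i
    using semideviation_pos[OF assms(1) Pi_mem[OF assms(2) that] assms(4) assms(5)[OF that]] .
  show ?thesis unfolding dev_sum_def
    using j E assms(3)
    by (intro sum_pos2[of _ j]) (auto simp: weights_def less_imp_le)
qed

lemma dev_sum_neg:
  assumes "semideviation I E" "x \<in> {1..n} \<rightarrow> I" "w \<in> weights n" "y \<in> I"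
    and "\<And>i. i \<in> {1..n} \<Longrightarrow> x i < y"
  shows "dev_sum E n x w y < 0"
proof -
  obtain j where j: "j \<in> {1..n}" "0 < w j" using weights_pos_index[OF assms(3)] .
  have E: "E (x i) y < 0" if "i \<in> {1..n}" for i
    using semideviation_neg[OF assms(1) Pi_mem[OF assms(2) that] assms(4) assms(5)[OF that]] .
  have "0 < (\<Sum>i=1..n. - (w i * E (x i) y))"
    using j E assms(3)
    by (intro sum_pos2[of _ j]) (auto simp: weights_def mult_pos_neg mult_nonneg_nonpos less_imp_le)
  then show ?thesis by (simp add: dev_sum_def sum_negf)
qed

section \<open>Deviation means as zeros of the deviation sum\<close>

text \<open>At points below \<open>a\<close> all deviations are positive and beyond \<open>b\<close>
  all are negative, so the deviation sum changes sign as required. The bound by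
  \<open>{a..b}\<close>, sharper than membership in \<open>I\<close>, supplies the compact set used
  when a mean is differentiated with respect to a weight.\<close>

lemma dev_mean_bounds:
  assumes I: "open I" "is_interval I" and E: "semideviation I E" "\<And>x. x \<in> I \<Longrightarrow> continuous_on I (E x)"
    and x: "x \<in> {1..n} \<rightarrow> I" and w: "w \<in> weights n" and M: "M \<in> dev_means I E"
    and ab: "a \<in> I" "b \<in> I" "\<And>i. i \<in> {1..n} \<Longrightarrow> x i \<in> {a..b}"
  shows "M n x w \<in> {a..b}" and "dev_sum E n x w (M n x w) = 0"
proof -
  have cont: "continuous_on I (dev_sum E n x w)"
    unfolding dev_sum_def by (intro continuous_intros E(2) Pi_mem[OF x])
  have "a \<le> b"
    using weights_pos_index[OF w] ab(3) by (metis atLeastAtMost_iff order_trans)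
  have pos: "0 < dev_sum E n x w y" if "y \<in> I" "y < a" for y
    using that ab(3) by (intro dev_sum_pos[OF E(1) x w]) force+
  have neg: "dev_sum E n x w y < 0" if "y \<in> I" "b < y" for y
    using that ab(3) by (intro dev_sum_neg[OF E(1) x w]) force+
  \<comment> \<open>What remains for each mean is that its defining set lies between the strict and
    the weak sign sets.\<close>
  note low = Inf_sign_change[OF I cont ab(1,2) \<open>a \<le> b\<close> pos neg]
  note upp = Sup_sign_change[OF I cont ab(1,2) \<open>a \<le> b\<close> pos neg]
  consider "M = D_lower2 I E" | "M = D_lower I E" | "M = D_upper I E" | "M = D_upper2 I E"
    using M by (auto simp: dev_means_def)
  then have "M n x w \<in> {a..b} \<and> dev_sum E n x w (M n x w) = 0"
  proof cases
    case 1
    show ?thesis unfolding 1 D_lower2_def by (intro conjI low) auto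
  next
    case 2
    show ?thesis unfolding 2 D_lower_def by (intro conjI low) auto
  next
    case 3
    show ?thesis unfolding 3 D_upper_def by (intro conjI upp) auto
  next
    case 4
    show ?thesis unfolding 4 D_upper2_def by (intro conjI upp) auto
  qed
  then show "M n x w \<in> {a..b}" "dev_sum E n x w (M n x w) = 0" by auto
qed

lemma finite_family_bounds:
  fixes x :: "nat \<Rightarrow> real"
  assumes "x \<in> {1..n} \<rightarrow> I" "w \<in> weights n"
  obtains a b where "a \<in> I" "b \<in> I" "\<And>i. i \<in> {1..n} \<Longrightarrow> x i \<in> {a..b}"
proof
  have ne: "x ` {1..n} \<noteq> {}" using weights_pos_index[OF assms(2)] by (metis empty_iff image_is_empty)
  show "Min (x ` {1..n}) \<in> I" "Max (x ` {1..n}) \<in> I"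
    using Min_in[OF _ ne] Max_in[OF _ ne] assms(1) by auto
  show "\<And>i. i \<in> {1..n} \<Longrightarrow> x i \<in> {Min (x ` {1..n})..Max (x ` {1..n})}" by auto
qed

lemma dev_mean_zero:
  assumes I: "open I" "is_interval I" and E: "semideviation I E" "\<And>x. x \<in> I \<Longrightarrow> continuous_on I (E x)"
    and x: "x \<in> {1..n} \<rightarrow> I" and w: "w \<in> weights n" and M: "M \<in> dev_means I E"
  shows "M n x w \<in> I" and "dev_sum E n x w (M n x w) = 0"
proof -
  obtain a b where ab: "a \<in> I" "b \<in> I" "\<And>i. i \<in> {1..n} \<Longrightarrow> x i \<in> {a..b}"
    using finite_family_bounds[OF x w] by metis
  note z = dev_mean_bounds[OF I E x w M ab]
  show "M n x w \<in> I" using mem_is_interval_1_I[OF I(2) ab(1,2)] z(1) by simp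
  show "dev_sum E n x w (M n x w) = 0" by (rule z(2))
qed

text \<open>A nonpositive deviation sum puts \<open>z\<close> into the set whose infimum is taken.
  This is how (iii) yields the inequality of (i); for the strict set of \<open>D_lower\<close> a
  zero would not be a member.\<close>

lemma D_lower2_le:
  assumes E: "semideviation I E" and x: "x \<in> {1..n} \<rightarrow> I" and w: "w \<in> weights n"
    and z: "z \<in> I" "dev_sum E n x w z \<le> 0"
  shows "D_lower2 I E n x w \<le> z"
proof -
  obtain a b where a: "\<And>i. i \<in> {1..n} \<Longrightarrow> x i \<in> {a..b}"
    using finite_family_bounds[OF x w] by metis
  have "a \<le> y" if "y \<in> I" "dev_sum E n x w y \<le> 0" for y
    using dev_sum_pos[OF E x w \<open>y \<in> I\<close>] a that by force
  then have "bdd_below {y \<in> I. dev_sum E n x w y \<le> 0}" by (auto simp: bdd_below_def)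
  then show ?thesis unfolding D_lower2_def using z by (intro cInf_lower) auto
qed

section \<open>Derivative of a two-point mean with respect to a weight\<close>

text \<open>Outside a neighbourhood \<open>U\<close> of \<open>u\<close>, the absolute value of
  \<open>g\<close> has a positive minimum on the compact set \<open>C - U\<close>; once
  \<open>g (m t)\<close> is smaller than that, \<open>m t\<close> must lie in \<open>U\<close>. This
  gives convergence of a family of means whose continuity is not known beforehand.\<close>

lemma compact_unique_zero_tendsto:
  fixes g :: "'a::metric_space \<Rightarrow> real"
  assumes "compact C" "continuous_on C g" "\<And>y. y \<in> C \<Longrightarrow> g y = 0 \<Longrightarrow> y = u"
    and C: "eventually (\<lambda>t. m t \<in> C) \<F>" and lim: "((\<lambda>t. g (m t)) \<longlongrightarrow> 0) \<F>"
  shows "(m \<longlongrightarrow> u) \<F>"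
proof (rule topological_tendstoI)
  fix U assume U: "open U" "u \<in> U"
  show "eventually (\<lambda>t. m t \<in> U) \<F>"
  proof (cases "C - U = {}")
    case True
    then show ?thesis using C by (auto elim: eventually_mono)
  next
    case False
    have "continuous_on (C - U) (\<lambda>y. \<bar>g y\<bar>)"
      using assms(2) by (intro continuous_intros) (auto intro: continuous_on_subset)
    then obtain y where y: "y \<in> C - U" "\<And>z. z \<in> C - U \<Longrightarrow> \<bar>g y\<bar> \<le> \<bar>g z\<bar>"
      using continuous_attains_inf[of "C - U" "\<lambda>y. \<bar>g y\<bar>"] compact_diff[OF assms(1) U(1)] False by blast
    then have "0 < \<bar>g y\<bar>" using assms(3) U by auto
    with lim have "eventually (\<lambda>t. \<bar>g (m t)\<bar> < \<bar>g y\<bar>) \<F>"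
      by (auto simp: tendsto_iff dist_real_def)
    with C show ?thesis
      by eventually_elim (use y in force)
  qed
qed

lemma normalizableD:
  assumes "normalizable I E" "open I"
  shows "semideviation I E" "\<And>x. x \<in> I \<Longrightarrow> continuous_on I (E x)"
    and "\<And>x. x \<in> I \<Longrightarrow> (E x has_real_derivative deriv (E x) x) (at x)"
    and "\<And>x. x \<in> I \<Longrightarrow> deriv (E x) x < 0"
  using assms
  by (auto simp: normalizable_def at_within_open[OF _ assms(2)] DERIV_deriv_iff_real_differentiable)

text \<open>The definition of a semideviation leaves the diagonal open. Continuity settles it:
  \<open>E u\<close> is positive to the left of \<open>u\<close> and negative to the right.\<close>

lemma semideviation_diag:
  assumes "open I" "semideviation I E" "u \<in> I" "continuous_on I (E u)"
  shows "E u u = 0"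
proof -
  have c: "continuous (at u) (E u)"
    using assms(1,3,4) by (simp add: continuous_on_eq_continuous_at)
  have ev: "eventually (\<lambda>y. y \<in> I \<and> y \<in> S) (at u within S)" for S
    using assms(1,3) unfolding eventually_at_topological by blast
  have "eventually (\<lambda>y. 0 \<le> E u y) (at_left u)"
    using ev[of "{..<u}"]
    by (auto elim!: eventually_mono intro!: less_imp_le semideviation_pos[OF assms(2,3)])
  moreover have "eventually (\<lambda>y. E u y \<le> 0) (at_right u)"
    using ev[of "{u<..}"]
    by (auto elim!: eventually_mono intro!: less_imp_le semideviation_neg[OF assms(2,3)])
  moreover have "(E u \<longlongrightarrow> E u u) (at_left u)" "(E u \<longlongrightarrow> E u u) (at_right u)"
    using c by (auto simp: continuous_at intro: tendsto_within_subset)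
  ultimately have "0 \<le> E u u" "E u u \<le> 0"
    using tendsto_lowerbound[of "E u" "E u u" "at_left u" 0]
      tendsto_upperbound[of "E u" "E u u" "at_right u" 0] by auto
  then show ?thesis by simp
qed

text \<open>\<open>E p\<close> is only known to be continuous and \<open>E u\<close> to be
  differentiable at \<open>u\<close>, so the implicit differentiation is done directly: with
  \<open>E u y = q y * (y - u)\<close> the equation becomes
  \<open>(m t - u) / t = E p (m t) / (- q (m t))\<close>, and the right-hand side converges once
  \<open>m t\<close> tends to \<open>u\<close>.\<close>

lemma perturbed_zero_derivative:
  assumes I: "open I" "is_interval I" and E: "normalizable I E" and pu: "p \<in> I" "u \<in> I"
    and m: "\<And>t. 0 \<le> t \<Longrightarrow> m t \<in> {min p u..max p u}"
    and zero: "\<And>t. 0 \<le> t \<Longrightarrow> t * E p (m t) + E u (m t) = 0"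
  shows "m 0 = u" and "(m has_real_derivative normalization E p u) (at 0 within {0..})"
proof -
  note E = normalizableD[OF E I(1)]
  define C where "C = {min p u..max p u}"
  have "C \<subseteq> I" 
    using mem_is_interval_1_I[OF I(2), of "min p u" "max p u"] pu by (auto simp: C_def min_def max_def)
  have uniq: "y = u" if "y \<in> I" "E u y = 0" for y
    using semideviation_pos[OF E(1) pu(2), of y] semideviation_neg[OF E(1) pu(2), of y] that
    by (cases y u rule: linorder_cases) auto
  show m0: "m 0 = u"
    using zero[of 0] m[of 0] \<open>C \<subseteq> I\<close> by (intro uniq) (auto simp: C_def)
  let ?F = "at 0 within {0::real..}"
  \<comment> \<open>The filter omits 0 itself, so division by \<open>t\<close> is
    legitimate.\<close>
  have ev: "eventually (\<lambda>t. 0 < t) ?F"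
    by (auto simp: eventually_at_filter)
  have contC: "continuous_on C (E x)" if "x \<in> I" for x
    using E(2)[OF that] \<open>C \<subseteq> I\<close> by (rule continuous_on_subset)
  \<comment> \<open>A bound of \<open>E p\<close> on \<open>C\<close> makes \<open>E u (m t)\<close>
    of order \<open>t\<close>; its unique zero then attracts \<open>m t\<close>.\<close>
  have "compact C" by (simp add: C_def)
  then have "bounded (E p ` C)"
    by (intro compact_imp_bounded compact_continuous_image contC pu(1))
  then obtain B where B: "\<And>y. y \<in> C \<Longrightarrow> \<bar>E p y\<bar> \<le> B"
    by (auto simp: bounded_iff)
  have mlim: "(m \<longlongrightarrow> u) ?F"
  proof (rule compact_unique_zero_tendsto[OF \<open>compact C\<close> contC[OF pu(2)]])
    show "y = u" if "y \<in> C" "E u y = 0" for y using that \<open>C \<subseteq> I\<close> uniq by auto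
    show "eventually (\<lambda>t. m t \<in> C) ?F" using ev m by (auto elim!: eventually_mono simp: C_def)
    have "((\<lambda>t. t * B) \<longlongrightarrow> 0 * B) ?F" by (intro tendsto_intros)
    moreover have "eventually (\<lambda>t. norm (E u (m t)) \<le> t * B) ?F"
      using ev
    proof eventually_elim
      case (elim t)
      then have "E u (m t) = - (t * E p (m t))"
        using zero[of t] by linarith
      then have "norm (E u (m t)) = t * \<bar>E p (m t)\<bar>"
        using elim by (simp add: abs_mult)
      also have "\<dots> \<le> t * B"
        using elim B[of "m t"] m[of t] by (intro mult_left_mono) (auto simp: C_def)
      finally show ?case .
    qed
    ultimately show "((\<lambda>t. E u (m t)) \<longlongrightarrow> 0) ?F"
      using Lim_null_comparison[of "\<lambda>t. E u (m t)" "\<lambda>t. t * B"] by simp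
  qed
  \<comment> \<open>Caratheodory's form of differentiability: the factor \<open>q\<close> makes
    sense also when \<open>m t = u\<close>, where a difference quotient would not.\<close>
  obtain q where q: "\<And>y. E u y - E u u = q y * (y - u)" "isCont q u" "q u = deriv (E u) u"
    using E(3)[OF pu(2)] unfolding CARAT_DERIV by blast
  have qlim: "((\<lambda>t. q (m t)) \<longlongrightarrow> deriv (E u) u) ?F"
    using isCont_tendsto_compose[OF q(2) mlim] q(3) by simp
  have "isCont (E p) u"
    using E(2)[OF pu(1)] I(1) pu(2) by (simp add: continuous_on_eq_continuous_at)
  then have "((\<lambda>t. E p (m t)) \<longlongrightarrow> E p u) ?F"
    using mlim by (rule isCont_tendsto_compose)
  then have "((\<lambda>t. E p (m t) / (- q (m t))) \<longlongrightarrow> normalization E p u) ?F"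
    unfolding normalization_def using qlim E(4)[OF pu(2)] by (intro tendsto_intros) auto
  moreover have "eventually (\<lambda>t. q (m t) < 0) ?F"
    using order_tendstoD(2)[OF qlim] E(4)[OF pu(2)] by blast
  then have "eventually (\<lambda>t. E p (m t) / (- q (m t)) = (m t - m 0) / (t - 0)) ?F"
    using ev
  proof eventually_elim
    case (elim t)
    have "t * E p (m t) + q (m t) * (m t - u) = 0"
      using zero[of t] q(1)[of "m t"] semideviation_diag[OF I(1) E(1) pu(2) E(2)[OF pu(2)]] elim by simp
    then show ?case using elim by (simp add: m0 field_simps)
  qed
  ultimately show "(m has_real_derivative normalization E p u) ?F"
    unfolding has_field_derivative_iff by (rule Lim_transform_eventually)
qed

text \<open>Weights \<open>t\<close> and 1 make \<open>p\<close> a small perturbation of the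
  constant tuple \<open>u\<close>, and the mean solves \<open>t * E p y + E u y = 0\<close>. The
  derivative at 0 is the same for all four means, which is why one pair of means in (ii) is
  enough.\<close>

lemma mean_derivative:
  assumes I: "open I" "is_interval I" and E: "normalizable I E" and pu: "p \<in> I" "u \<in> I"
    and M: "M \<in> dev_means I E"
  defines "m \<equiv> \<lambda>t. M 2 (\<lambda>i. if i = 1 then p else u) (\<lambda>i. if i = 1 then t else 1)"
  shows "m 0 = u" and "(m has_real_derivative normalization E p u) (at 0 within {0..})"
proof -
  have "m t \<in> {min p u..max p u} \<and> t * E p (m t) + E u (m t) = 0" if "0 \<le> t" for t
  proof -
    let ?x = "\<lambda>i::nat. if i = 1 then p else u" and ?w = "\<lambda>i::nat. if i = 1 then t else 1"
    have two: "{Suc 0..2} = {1, 2}" by auto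
    have w: "?w \<in> weights 2" using that by (auto simp: weights_def two)
    have mm: "min p u \<in> I" "max p u \<in> I" using pu by (auto simp: min_def max_def)
    show ?thesis
      using dev_mean_bounds[OF I normalizableD(1,2)[OF E I(1)] _ w M mm, of ?x] pu
      by (auto simp: m_def dev_sum_def two)
  qed
  then show "m 0 = u" "(m has_real_derivative normalization E p u) (at 0 within {0..})"
    using perturbed_zero_derivative[OF I E pu, of m] by auto
qed

section \<open>One-sided comparison and the chain rule\<close>

text \<open>One-sided because weights are nonnegative: the means are controlled only for
  \<open>0 \<le> t\<close>.\<close>

lemma right_derivative_mono:
  fixes g h :: "real \<Rightarrow> real"
  assumes "(g has_real_derivative a) (at c within {c..})" "(h has_real_derivative b) (at c within {c..})"
    and "g c = h c" "\<And>t. c \<le> t \<Longrightarrow> g t \<le> h t"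
  shows "a \<le> b"
proof (rule tendsto_le)
  show "((\<lambda>t. (g t - g c) / (t - c)) \<longlongrightarrow> a) (at c within {c..})"
    "((\<lambda>t. (h t - h c) / (t - c)) \<longlongrightarrow> b) (at c within {c..})"
    using assms(1,2) by (simp_all add: has_field_derivative_iff)
  show "eventually (\<lambda>t. (g t - g c) / (t - c) \<le> (h t - h c) / (t - c)) (at c within {c..})"
    using assms(3,4) by (auto simp: eventually_at_filter intro!: divide_right_mono always_eventually)
  show "at c within {c..} \<noteq> bot" by (simp add: at_within_Ici_at_right)
qed

text \<open>The total derivative \<open>f'\<close> is linear, hence determined by its values at
  \<open>(1, 0)\<close> and \<open>(0, 1)\<close>; restricting \<open>f\<close> to coordinate lines
  identifies these as the partial derivatives.\<close>

lemma chain_rule_partials: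
  fixes f :: "real \<times> real \<Rightarrow> real"
  assumes "f differentiable (at (m t, k t))"
    and "(m has_real_derivative a) (at t within S)" "(k has_real_derivative b) (at t within S)"
  shows "((\<lambda>s. f (m s, k s)) has_real_derivative
           deriv (\<lambda>s. f (s, k t)) (m t) * a + deriv (\<lambda>s. f (m t, s)) (k t) * b) (at t within S)"
proof -
  obtain f' where f': "(f has_derivative f') (at (m t, k t))"
    using assms(1) by (auto simp: differentiable_def)
  have lin: "linear f'" using f' by (rule has_derivative_linear)
  have scale: "f' (c * x, c * y) = c * f' (x, y)" for c x y
    using linear_scale[OF lin, of c "(x, y)"] by simp
  \<comment> \<open>General in the curve and in \<open>T\<close>, to serve both the two coordinate
    lines and the given curve.\<close>
  have comp: "((\<lambda>s. f (g s, h s)) has_real_derivative f' (x, y)) (at r within T)"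
    if "(g has_real_derivative x) (at r within T)" "(h has_real_derivative y) (at r within T)"
      "g r = m t" "h r = k t" for g h x y r T
  proof -
    have "((\<lambda>s. f (g s, h s)) has_derivative (\<lambda>s. f' (x * s, y * s))) (at r within T)"
      using that(1,2) f' that(3,4)
      by (auto intro!: has_derivative_compose[of "\<lambda>s. (g s, h s)"] has_derivative_Pair
          simp: has_field_derivative_def)
    moreover have "f' (x * s, y * s) = f' (x, y) * s" for s
      using scale[of s x y] by (simp add: mult.commute)
    ultimately show ?thesis by (simp add: has_field_derivative_def)
  qed
  have "deriv (\<lambda>s. f (s, k t)) (m t) = f' (1, 0)" "deriv (\<lambda>s. f (m t, s)) (k t) = f' (0, 1)"
    by (auto intro!: DERIV_imp_deriv comp derivative_eq_intros)
  moreover have "f' (a, b) = f' (1, 0) * a + f' (0, 1) * b"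
    using linear_add[OF lin, of "(a, 0)" "(0, b)"] scale[of a 1 0] scale[of b 0 1] by simp
  ultimately show ?thesis using comp[OF assms(2,3)] by simp
qed

section \<open>Equivalence of the three assertions\<close>

theorem theorem7p1:
  fixes I J K :: "real set"
    and E F G :: "real \<Rightarrow> real \<Rightarrow> real"
    and f :: "real \<times> real \<Rightarrow> real"
  assumes "open I" "is_interval I"
    and "open J" "is_interval J"
    and "open K" "is_interval K"
    and "normalizable I E" "normalizable J F" "normalizable K G"
    and "f \<in> J \<times> K \<rightarrow> I"
    and "f differentiable_on (J \<times> K)"
  defines "assertion_i \<equiv>
      (\<forall>M \<in> dev_means J F. \<forall>N \<in> dev_means K G.
        \<forall>n. \<forall>x \<in> {1..n} \<rightarrow> J. \<forall>y \<in> {1..n} \<rightarrow> K. \<forall>w \<in> weights n.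
          D_lower2 I E n (\<lambda>i. f (x i, y i)) w \<le> f (M n x w, N n y w))"
    and "assertion_ii \<equiv>
      (\<exists>M \<in> dev_means J F. \<exists>N \<in> dev_means K G.
        \<forall>n. \<forall>x \<in> {1..n} \<rightarrow> J. \<forall>y \<in> {1..n} \<rightarrow> K. \<forall>w \<in> weights n.
          D_lower2 I E n (\<lambda>i. f (x i, y i)) w \<le> f (M n x w, N n y w))"
    and "assertion_iii \<equiv>
      (\<forall>p\<in>J. \<forall>u\<in>J. \<forall>q\<in>K. \<forall>v\<in>K.
        normalization E (f (p, q)) (f (u, v))
          \<le> deriv (\<lambda>t. f (t, v)) u * normalization F p u
            + deriv (\<lambda>t. f (u, t)) v * normalization G q v)"
  shows "(assertion_i \<longleftrightarrow> assertion_ii) \<and> (assertion_ii \<longleftrightarrow> assertion_iii)"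
proof -
  note nE = normalizableD[OF assms(7,1)] and nF = normalizableD[OF assms(8,3)]
    and nG = normalizableD[OF assms(9,5)]
  \<comment> \<open>Passing from all means to some means rests on having at least one on each
    side.\<close>
  have means: "D_lower2 J F \<in> dev_means J F" "D_lower2 K G \<in> dev_means K G"
    by (simp_all add: dev_means_def)
  have i_ii: "assertion_ii" if "assertion_i"
    using bspec[OF bspec[OF that[unfolded assertion_i_def] means(1)] means(2)]
    unfolding assertion_ii_def by (intro bexI[OF _ means(1)] bexI[OF _ means(2)])
  have iii_i: "assertion_i" if iii: "assertion_iii"
    unfolding assertion_i_def
  proof (intro ballI allI)
    fix M N n x y w
    assume M: "M \<in> dev_means J F" and N: "N \<in> dev_means K G"
      and x: "x \<in> {1..n} \<rightarrow> J" and y: "y \<in> {1..n} \<rightarrow> K" and w: "w \<in> weights n"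
    define u v where "u = M n x w" and "v = N n y w"
    have u: "u \<in> J" "dev_sum F n x w u = 0"
      using dev_mean_zero[OF assms(3,4) nF(1,2) x w M] by (auto simp: u_def)
    have v: "v \<in> K" "dev_sum G n y w v = 0"
      using dev_mean_zero[OF assms(5,6) nG(1,2) y w N] by (auto simp: v_def)
    have fI: "f (s, t) \<in> I" if "s \<in> J" "t \<in> K" for s t
      using assms(10) that by auto
    \<comment> \<open>The normalizing factor depends on the second argument alone, so it is common
      to all summands.\<close>
    have normalized: "(\<Sum>i=1..n. w i * normalization D (z i) s) = dev_sum D n z w s / (- deriv (D s) s)"
      for D :: "real \<Rightarrow> real \<Rightarrow> real" and z s
      by (simp add: normalization_def dev_sum_def sum_divide_distrib sum_negf)
    define \<alpha> \<beta> where "\<alpha> = deriv (\<lambda>t. f (t, v)) u" and "\<beta> = deriv (\<lambda>t. f (u, t)) v"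
    have "(\<Sum>i=1..n. w i * normalization E (f (x i, y i)) (f (u, v)))
        \<le> (\<Sum>i=1..n. w i * (\<alpha> * normalization F (x i) u + \<beta> * normalization G (y i) v))"
      using iii Pi_mem[OF x] Pi_mem[OF y] w u(1) v(1) unfolding assertion_iii_def \<alpha>_def \<beta>_def
      by (intro sum_mono mult_left_mono) (simp_all add: weights_def)
    also have "\<dots> = \<alpha> * (\<Sum>i=1..n. w i * normalization F (x i) u)
        + \<beta> * (\<Sum>i=1..n. w i * normalization G (y i) v)"
      by (simp add: sum_distrib_left sum.distrib algebra_simps)
    \<comment> \<open>Both sums vanish at the means, so the signs of \<open>\<alpha>\<close> and
      \<open>\<beta>\<close> do not matter.\<close>
    also have "\<dots> = 0" unfolding normalized using u v by simp
    finally have "dev_sum E n (\<lambda>i. f (x i, y i)) w (f (u, v)) / (- deriv (E (f (u, v))) (f (u, v))) \<le> 0"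
      unfolding normalized .
    then have "dev_sum E n (\<lambda>i. f (x i, y i)) w (f (u, v)) \<le> 0"
      using nE(4)[OF fI[OF u(1) v(1)]] by (simp add: divide_le_0_iff zero_le_divide_iff)
    then show "D_lower2 I E n (\<lambda>i. f (x i, y i)) w \<le> f (M n x w, N n y w)"
      unfolding u_def[symmetric] v_def[symmetric]
      by (intro D_lower2_le[OF nE(1) _ w] Pi_I fI Pi_mem[OF x] Pi_mem[OF y] u(1) v(1))
  qed
  have ii_iii: "assertion_iii" if ii: "assertion_ii"
    unfolding assertion_iii_def
  proof (intro ballI)
    fix p u q v assume pu: "p \<in> J" "u \<in> J" and qv: "q \<in> K" "v \<in> K"
    obtain M N where M: "M \<in> dev_means J F" and N: "N \<in> dev_means K G"
      and le: "\<And>n x y w. x \<in> {1..n} \<rightarrow> J \<Longrightarrow> y \<in> {1..n} \<rightarrow> K \<Longrightarrow> w \<in> weights n \<Longrightarrow>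
        D_lower2 I E n (\<lambda>i. f (x i, y i)) w \<le> f (M n x w, N n y w)"
      using ii unfolding assertion_ii_def by blast
    let ?w = "\<lambda>t i. if i = (1::nat) then t else 1 :: real"
    define m where "m = (\<lambda>t. M 2 (\<lambda>i. if i = 1 then p else u) (?w t))"
    define k where "k = (\<lambda>t. N 2 (\<lambda>i. if i = 1 then q else v) (?w t))"
    \<comment> \<open>The left-hand side of (ii) is itself a two-point mean, so it is differentiated
      by the same lemma.\<close>
    define e where "e = (\<lambda>t. D_lower2 I E 2 (\<lambda>i. if i = 1 then f (p, q) else f (u, v)) (?w t))"
    have fI: "f (p, q) \<in> I" "f (u, v) \<in> I"
      using assms(10) pu qv by auto
    have m: "m 0 = u" "(m has_real_derivative normalization F p u) (at 0 within {0..})"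
      unfolding m_def by (rule mean_derivative[OF assms(3,4,8) pu M])+
    have k: "k 0 = v" "(k has_real_derivative normalization G q v) (at 0 within {0..})"
      unfolding k_def by (rule mean_derivative[OF assms(5,6,9) qv N])+
    have "D_lower2 I E \<in> dev_means I E" by (simp add: dev_means_def)
    note D = mean_derivative[OF assms(1,2,7) fI this]
    have e: "e 0 = f (u, v)" "(e has_real_derivative normalization E (f (p, q)) (f (u, v))) (at 0 within {0..})"
      unfolding e_def by (rule D)+
    have "f differentiable (at (u, v))"
      using assms(11) pu qv open_Times[OF assms(3,5)] by (simp add: differentiable_on_eq_differentiable_at)
    then have fmk: "((\<lambda>s. f (m s, k s)) has_real_derivative
        deriv (\<lambda>t. f (t, v)) u * normalization F p u + deriv (\<lambda>t. f (u, t)) v * normalization G q v)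
        (at 0 within {0..})"
      using chain_rule_partials[OF _ m(2) k(2), of f] unfolding m(1) k(1) by blast
    \<comment> \<open>This is (ii) for two points with weights \<open>t\<close> and 1.\<close>
    have "e t \<le> f (m t, k t)" if "0 \<le> t" for t
    proof -
      have "{Suc 0..2} = {1, 2}" by auto
      then have "?w t \<in> weights 2" using that by (auto simp: weights_def)
      moreover have "(\<lambda>i. f (if i = 1 then p else u, if i = 1 then q else v)) =
          (\<lambda>i::nat. if i = 1 then f (p, q) else f (u, v))" by auto
      ultimately show ?thesis
        using le[of "\<lambda>i. if i = 1 then p else u" 2 "\<lambda>i. if i = 1 then q else v" "?w t"] pu qv
        by (simp add: e_def m_def k_def Pi_def)
    qed
    \<comment> \<open>Both sides equal \<open>f (u, v)\<close> at 0, so the inequality passes to the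
      right derivatives.\<close>
    then show "normalization E (f (p, q)) (f (u, v))
        \<le> deriv (\<lambda>t. f (t, v)) u * normalization F p u + deriv (\<lambda>t. f (u, t)) v * normalization G q v"
      by (intro right_derivative_mono[OF e(2) fmk]) (simp_all only: m(1) k(1) e(1))
  qed
  show ?thesis using i_ii iii_i ii_iii by blast
qed

end
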